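(* Let $n\geq 2$ and let $v_1,v_2,\dots,v_{n+1}$ be points in $n$-dimensional hyperbolic space $H^n$, with distance function $\varrho$, that all belong to a common horosphere or all belong to a common hypersphere. Let $B$ be the $(n+1)\times(n+1)$ matrix with entries $B_{ij}=\sinh^2\tfrac12\varrho(v_i,v_j)$. Then $v_1,v_2,\dots,v_{n+1}$ lie on a common hyperplane of $H^n$ if and only if $\det B=0$.
   Context: Lorentzian model: let $\mathbb{R}^{n,1}$ be $\mathbb{R}^{n+1}$ with the inner product $\langle x,y\rangle=x_1y_1+\dots+x_ny_n-x_{n+1}y_{n+1}$, and let $\|x\|^2=\langle x,x\rangle$. A vector $x$ is lightlike if $\|x\|^2=0$. Then $H^n$ is modelled by $\mathcal{H}^n=\{x\in\mathbb{R}^{n,1}:\|x\|^2=-1,\ x_{n+1}>0\}$ with distance function $\varrho$ given by $\cosh\varrho(x,y)=-\langle x,y\rangle$. A hyperplane in $\mathcal{H}^n$ is the nonempty intersection of $\mathcal{H}^n$ with a codimension 1 subspace of $\mathbb{R}^{n,1}$. A hypersphere in $\mathcal{H}^n$ is a set $\{x\in\mathcal{H}^n:\varrho(x,c)=r\}$ for some $c\in\mathcal{H}^n$ and $r>0$. A horosphere in $\mathcal{H}^n$ is a (nonempty) set $\{x\in\mathcal{H}^n:\langle x,v\rangle=-1/\sqrt2\}$, where $v$ is a (nonzero) lightlike vector. *)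

theory Defs
  imports "HOL-Analysis.Analysis"
begin

text \<open>
  The space \<open>\<real>\<^sup>n\<^sup>,\<^sup>1\<close> is the product type \<open>(real ^ 'n) \<times> real\<close> with \<open>n = CARD('n)\<close>; the second
  component is the timelike coordinate \<open>x\<^sub>n\<^sub>+\<^sub>1\<close>.
\<close>

type_synonym 'n lorentz = "(real ^ 'n) \<times> real"

definition lorentz_inner :: "'n::finite lorentz \<Rightarrow> 'n lorentz \<Rightarrow> real" where
  "lorentz_inner x y = (\<Sum>i\<in>UNIV. fst x $ i * fst y $ i) - snd x * snd y"

definition lightlike :: "'n::finite lorentz \<Rightarrow> bool" where
  "lightlike x \<longleftrightarrow> lorentz_inner x x = 0"

definition hyp_space :: "'n::finite lorentz set" where
  "hyp_space = {x. lorentz_inner x x = - 1 \<and> snd x > 0}"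

text \<open>
  On \<open>hyp_space\<close> one has \<open>- lorentz_inner x y \<ge> 1\<close>, so this is the unique nonnegative number
  whose \<open>cosh\<close> is \<open>- lorentz_inner x y\<close>. Outside \<open>hyp_space\<close> the value is meaningless.
\<close>

definition hyp_dist :: "'n::finite lorentz \<Rightarrow> 'n lorentz \<Rightarrow> real" where
  "hyp_dist x y = arcosh (- lorentz_inner x y)"

definition is_hyperplane :: "'n::finite lorentz set \<Rightarrow> bool" where
  "is_hyperplane P \<longleftrightarrow> P \<noteq> {} \<and>
     (\<exists>S. subspace S \<and> dim S + 1 = DIM('n lorentz) \<and> P = hyp_space \<inter> S)"

definition is_hypersphere :: "'n::finite lorentz set \<Rightarrow> bool" where
  "is_hypersphere P \<longleftrightarrow>
     (\<exists>c r. c \<in> hyp_space \<and> r > 0 \<and> P = {x \<in> hyp_space. hyp_dist x c = r})"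

text \<open>
  The nonemptiness condition forces \<open>v\<close> to be future-directed (\<open>snd v > 0\<close>).
\<close>

definition is_horosphere :: "'n::finite lorentz set \<Rightarrow> bool" where
  "is_horosphere P \<longleftrightarrow> P \<noteq> {} \<and>
     (\<exists>v. v \<noteq> 0 \<and> lightlike v \<and> P = {x \<in> hyp_space. lorentz_inner x v = - 1 / sqrt 2})"

end

theory Submission
  imports Defs
begin

text \<open>
  Why the theorem holds. Since \<open>sinh\<^sup>2 (\<rho> / 2) = (cosh \<rho> - 1) / 2\<close>, the matrix \<open>B\<close> is
  \<open>- (G + J) / 2\<close>, where \<open>G\<close> is the Lorentzian Gram matrix of the points and \<open>J\<close> is the all-ones
  matrix. Horospheres and hyperspheres are put on the same footing: on either of them some fixed
  vector \<open>u\<close> satisfies \<open>\<langle>x, u\<rangle> = - 1\<close>, and \<open>\<langle>u, u\<rangle> \<noteq> - 1\<close> (a rescaling of the defining lightlike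
  vector gives \<open>0\<close>, and a rescaling of the centre gives \<open>- 1 / cosh\<^sup>2 r\<close> with \<open>r > 0\<close>).

  For coefficients \<open>a\<close> put \<open>w = (\<Sum>j. a\<^sub>j v\<^sub>j)\<close> and \<open>s = (\<Sum>j. a\<^sub>j)\<close>. Pairing \<open>w\<close> with \<open>u\<close> shows
  \<open>\<langle>w, u\<rangle> = - s\<close>, so \<open>J a\<close> can be read off from \<open>w\<close>, and
  \<open>B a = 0\<close> says exactly that \<open>w - s u\<close> is orthogonal to every \<open>v\<^sub>i\<close>. If the points lie on a
  hyperplane, they are linearly dependent: some \<open>a \<noteq> 0\<close> has \<open>w = 0\<close>, then \<open>s = 0\<close>, and \<open>B a = 0\<close>.
  If they do not, they form a basis, so \<open>B a = 0\<close> gives \<open>w = s u\<close> by nondegeneracy. Pairing with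
  \<open>u\<close> gives \<open>s (\<langle>u, u\<rangle> + 1) = 0\<close>, hence \<open>s = 0\<close>, \<open>w = 0\<close> and \<open>a = 0\<close>.
\<close>

text \<open>
  Reflecting the timelike coordinate turns the Lorentzian form into the Euclidean one, from which
  bilinearity and nondegeneracy are inherited.
\<close>

lemma lorentz_inner_eq_inner: "lorentz_inner x y = x \<bullet> (fst y, - snd y)"
  by (simp add: lorentz_inner_def inner_prod_def inner_vec_def)

lemma lorentz_inner_commute: "lorentz_inner x y = lorentz_inner y x"
  by (simp add: lorentz_inner_def mult.commute)

lemma linear_lorentz_inner_left: "linear (\<lambda>x. lorentz_inner x y)"
  by (rule linearI) (simp_all add: lorentz_inner_eq_inner inner_add_left)

lemma linear_lorentz_inner_right: "linear (lorentz_inner x)"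
proof -
  have "lorentz_inner x = (\<lambda>y. lorentz_inner y x)"
    by (intro ext lorentz_inner_commute)
  then show ?thesis
    using linear_lorentz_inner_left[of x] by simp
qed

lemma lorentz_inner_nondegenerate:
  assumes "\<And>x. lorentz_inner x z = 0"
  shows "z = 0"
proof -
  have "(fst z, - snd z) = 0"
    using assms[of "(fst z, - snd z)"] by (simp only: lorentz_inner_eq_inner inner_eq_zero_iff)
  then show ?thesis
    by (simp add: prod_eq_iff)
qed

text \<open>
  The reversed Cauchy-Schwarz inequality; it makes \<open>arcosh\<close> in the distance an honest inverse of
  \<open>cosh\<close>. Both norms of spatial parts are recovered from the timelike coordinates, which are
  positive, and \<open>(1 + p\<^sup>2) (1 + q\<^sup>2) - (1 + p q)\<^sup>2 = (p - q)\<^sup>2\<close>.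
\<close>

lemma hyp_space_lorentz_inner_ge_1:
  assumes "x \<in> hyp_space" "y \<in> hyp_space"
  shows "1 \<le> - lorentz_inner x y"
proof -
  let ?p = "norm (fst x)" and ?q = "norm (fst y)"
  have x: "(snd x)\<^sup>2 = 1 + ?p\<^sup>2" "snd x > 0" and y: "(snd y)\<^sup>2 = 1 + ?q\<^sup>2" "snd y > 0"
    using assms by (auto simp: hyp_space_def lorentz_inner_eq_inner inner_prod_def
        power2_norm_eq_inner power2_eq_square[of "snd _"])
  have "(snd x * snd y)\<^sup>2 - (1 + ?p * ?q)\<^sup>2 = (?p - ?q)\<^sup>2"
    by (simp add: power_mult_distrib x y) (simp add: power2_eq_square algebra_simps)
  then have "(1 + ?p * ?q)\<^sup>2 \<le> (snd x * snd y)\<^sup>2"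
    by (smt (verit) zero_le_power2)
  then have "1 + ?p * ?q \<le> snd x * snd y"
    by (rule power2_le_imp_le) (simp add: x(2) y(2) less_imp_le)
  moreover have "fst x \<bullet> fst y \<le> ?p * ?q"
    by (rule norm_cauchy_schwarz)
  ultimately show ?thesis
    by (simp add: lorentz_inner_eq_inner inner_prod_def)
qed

lemma cosh_hyp_dist:
  assumes "x \<in> hyp_space" "y \<in> hyp_space"
  shows "cosh (hyp_dist x y) = - lorentz_inner x y"
  unfolding hyp_dist_def by (rule cosh_arcosh_real[OF hyp_space_lorentz_inner_ge_1[OF assms]])

lemma sinh_half_hyp_dist_squared:
  assumes "x \<in> hyp_space" "y \<in> hyp_space"
  shows "(sinh (1 / 2 * hyp_dist x y))\<^sup>2 = - (lorentz_inner x y + 1) / 2"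
  using cosh_double[of "1 / 2 * hyp_dist x y"] cosh_hyp_dist[OF assms]
  by (simp add: cosh_square_eq)

lemma normal_vector_rescale:
  assumes "k \<noteq> 0" and "\<And>x. x \<in> P \<Longrightarrow> lorentz_inner x z = - k"
    and "lorentz_inner z z \<noteq> - k\<^sup>2"
  shows "\<exists>u. (\<forall>x\<in>P. lorentz_inner x u = - 1) \<and> lorentz_inner u u \<noteq> - 1"
proof (intro exI conjI ballI)
  show "lorentz_inner x ((1 / k) *\<^sub>R z) = - 1" if "x \<in> P" for x
    using assms(1) assms(2)[OF that] by (simp add: linear_cmul[OF linear_lorentz_inner_right])
  show "lorentz_inner ((1 / k) *\<^sub>R z) ((1 / k) *\<^sub>R z) \<noteq> - 1"
    using assms(1,3)
    by (simp add: linear_cmul[OF linear_lorentz_inner_right]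
        linear_cmul[OF linear_lorentz_inner_left] divide_simps power2_eq_square)
qed

text \<open>
  The only property of horospheres and hyperspheres that matters. Spheres of radius \<open>0\<close> are the
  excluded borderline case \<open>\<langle>u, u\<rangle> = - 1\<close>.
\<close>

lemma horosphere_or_hypersphere_normal_vector:
  assumes "is_horosphere P \<or> is_hypersphere P"
  shows "\<exists>u. (\<forall>x\<in>P. lorentz_inner x u = - 1) \<and> lorentz_inner u u \<noteq> - 1"
  using assms
proof
  assume "is_horosphere P"
  then obtain z where z: "lightlike z" "P = {x \<in> hyp_space. lorentz_inner x z = - 1 / sqrt 2}"
    unfolding is_horosphere_def by blast
  show ?thesis
    by (rule normal_vector_rescale[of "1 / sqrt 2" _ z]) (use z in \<open>auto simp: lightlike_def\<close>)
next
  assume "is_hypersphere P"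
  then obtain c r where c: "c \<in> hyp_space" "r > 0" "P = {x \<in> hyp_space. hyp_dist x c = r}"
    unfolding is_hypersphere_def by blast
  have "cosh r \<noteq> 1"
    using c(2) cosh_real_eq_iff[of r 0] by simp
  moreover have "cosh r > 0"
    by (rule cosh_real_pos)
  ultimately have "(cosh r)\<^sup>2 \<noteq> 1"
    unfolding power2_eq_1_iff by linarith
  show ?thesis
  proof (rule normal_vector_rescale[of "cosh r" _ c])
    show "lorentz_inner x c = - cosh r" if "x \<in> P" for x
      using cosh_hyp_dist[of x c] that c by simp
    show "lorentz_inner c c \<noteq> - (cosh r)\<^sup>2"
      using c(1) \<open>(cosh r)\<^sup>2 \<noteq> 1\<close> by (simp add: hyp_space_def)
  qed simp
qed

lemma linear_combination_linear: "linear (\<lambda>a::real^'m. \<Sum>j\<in>UNIV. (a $ j) *\<^sub>R v j)"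
  by (rule linearI) (simp_all add: scaleR_add_left sum.distrib scaleR_sum_right)

lemma range_linear_combination:
  "range (\<lambda>a::real^'m::finite. \<Sum>j\<in>UNIV. (a $ j) *\<^sub>R v j) = span (range v)"
  (is "range ?L = _")
proof
  show "range ?L \<subseteq> span (range v)"
    by (auto intro!: span_sum span_scale intro: span_base)
  have "v i = ?L (axis i 1)" for i
    by (simp add: axis_def if_distrib[of "\<lambda>t. t *\<^sub>R _"] cong: if_cong)
  then have "range v \<subseteq> range ?L"
    by blast
  moreover have "subspace (range ?L)"
    using linear_subspace_image[OF linear_combination_linear subspace_UNIV] .
  ultimately show "span (range v) \<subseteq> range ?L"
    by (rule span_minimal)
qed

lemma inj_linear_combination_iff:
  fixes v :: "'m::finite \<Rightarrow> 'b::euclidean_space"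
  assumes "CARD('m) = DIM('b)"
  shows "inj (\<lambda>a::real^'m. \<Sum>j\<in>UNIV. (a $ j) *\<^sub>R v j) \<longleftrightarrow> span (range v) = UNIV"
  using linear_injective_imp_surjective[OF linear_combination_linear[of v]]
    linear_surjective_imp_injective[OF linear_combination_linear[of v]] assms
  unfolding range_linear_combination[symmetric] by auto

lemma hyperplane_through_iff_span:
  fixes v :: "'m::finite \<Rightarrow> 'n::finite lorentz"
  assumes "\<And>i. v i \<in> hyp_space"
  shows "(\<exists>P. is_hyperplane P \<and> (\<forall>i. v i \<in> P)) \<longleftrightarrow> span (range v) \<noteq> UNIV"
proof
  assume "\<exists>P. is_hyperplane P \<and> (\<forall>i. v i \<in> P)"
  then obtain S :: "'n lorentz set"
    where S: "subspace S" "dim S + 1 = DIM('n lorentz)" "range v \<subseteq> S"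
    unfolding is_hyperplane_def by blast
  then have "span (range v) \<subseteq> S"
    by (simp add: span_minimal)
  moreover have "S \<noteq> UNIV"
    using S(2) by auto
  ultimately show "span (range v) \<noteq> UNIV"
    by blast
next
  assume "span (range v) \<noteq> UNIV"
  then obtain a where a: "a \<noteq> 0" "span (range v) \<subseteq> {x. a \<bullet> x = 0}"
    using span_not_univ_subset_hyperplane by blast
  have v: "v i \<in> hyp_space \<inter> {x. a \<bullet> x = 0}" for i
    using assms a(2) span_base[of "v i" "range v"] by blast
  have "is_hyperplane (hyp_space \<inter> {x. a \<bullet> x = 0})"
    unfolding is_hyperplane_def
  proof (intro conjI exI)
    show "hyp_space \<inter> {x. a \<bullet> x = 0} \<noteq> {}"
      using v by blast
    show "dim {x. a \<bullet> x = 0} + 1 = DIM('n lorentz)"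
      using dim_hyperplane[OF a(1)] DIM_positive[where 'a = "'n lorentz"] by linarith
  qed (simp_all add: subspace_hyperplane)
  with v show "\<exists>P. is_hyperplane P \<and> (\<forall>i. v i \<in> P)"
    by blast
qed

lemma det_eq_0_iff_kernel:
  fixes A :: "real ^ 'm ^ 'm"
  shows "det A = 0 \<longleftrightarrow> (\<exists>a. a \<noteq> 0 \<and> A *v a = 0)"
  using invertible_det_nz[of A] invertible_left_inverse[of A] matrix_left_invertible_ker[of A]
  by blast

theorem theoremB1:
  fixes v :: "'m::finite \<Rightarrow> 'n::finite lorentz"
    and B :: "real ^ 'm ^ 'm"
  assumes "CARD('n) \<ge> 2"
    and "CARD('m) = CARD('n) + 1"
    and "\<And>i. v i \<in> hyp_space"
    and "(\<exists>P. is_horosphere P \<and> (\<forall>i. v i \<in> P)) \<or> (\<exists>P. is_hypersphere P \<and> (\<forall>i. v i \<in> P))"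
    and "B = (\<chi> i j. (sinh (1 / 2 * hyp_dist (v i) (v j)))\<^sup>2)"
  shows "(\<exists>P. is_hyperplane P \<and> (\<forall>i. v i \<in> P)) \<longleftrightarrow> det B = 0"
proof -
  obtain u where u: "\<And>i. lorentz_inner (v i) u = - 1" "lorentz_inner u u \<noteq> - 1"
    using assms(4) horosphere_or_hypersphere_normal_vector by metis
  define L where "L = (\<lambda>a::real^'m. \<Sum>j\<in>UNIV. (a $ j) *\<^sub>R v j)"
  define s where "s = (\<lambda>a::real^'m. \<Sum>j\<in>UNIV. a $ j)"
  have linear_L: "linear L"
    unfolding L_def by (rule linear_combination_linear)
  have inj_L: "inj L \<longleftrightarrow> span (range v) = UNIV"
    unfolding L_def by (rule inj_linear_combination_iff) (simp add: assms(2))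
  have L_u: "lorentz_inner (L a) u = - s a" for a
    by (simp add: L_def s_def linear_sum[OF linear_lorentz_inner_left] u(1)
        linear_cmul[OF linear_lorentz_inner_left] sum_negf)
  have Ba: "(B *v a) $ i = - lorentz_inner (v i) (L a - s a *\<^sub>R u) / 2" for a i
  proof -
    have "(B *v a) $ i = (\<Sum>j\<in>UNIV. - (lorentz_inner (v i) (v j) + 1) / 2 * a $ j)"
      unfolding assms(5) matrix_vector_mult_def
        sinh_half_hyp_dist_squared[OF assms(3) assms(3)] by simp
    also have "\<dots> = - (\<Sum>j\<in>UNIV. a $ j * lorentz_inner (v i) (v j) + a $ j) / 2"
      by (simp add: sum_divide_distrib sum_negf[symmetric] algebra_simps)
    also have "\<dots> = - (lorentz_inner (v i) (L a) + s a) / 2"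
      by (simp add: sum.distrib L_def s_def linear_sum[OF linear_lorentz_inner_right]
          linear_cmul[OF linear_lorentz_inner_right])
    finally show ?thesis
      by (simp add: linear_diff[OF linear_lorentz_inner_right]
          linear_cmul[OF linear_lorentz_inner_right] u(1))
  qed
  have "\<not> inj L \<longleftrightarrow> det B = 0"
  proof
    assume "\<not> inj L"
    then obtain a where a: "a \<noteq> 0" "L a = 0"
      using linear_injective_0[OF linear_L] by blast
    then have "s a = 0"
      using L_u[of a] by (simp add: linear_0[OF linear_lorentz_inner_left])
    then have "B *v a = 0"
      by (simp add: vec_eq_iff Ba a(2) linear_0[OF linear_lorentz_inner_right])
    with a(1) show "det B = 0"
      unfolding det_eq_0_iff_kernel by blast
  next
    assume "det B = 0"
    then obtain a where a: "a \<noteq> 0" "B *v a = 0"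
      unfolding det_eq_0_iff_kernel by blast
    show "\<not> inj L"
    proof
      assume "inj L"
      have "lorentz_inner x (L a - s a *\<^sub>R u) = 0" for x
      proof (rule linear_eq_0_on_span[OF linear_lorentz_inner_left])
        show "x \<in> span (range v)"
          using \<open>inj L\<close> inj_L by blast
        show "lorentz_inner y (L a - s a *\<^sub>R u) = 0" if "y \<in> range v" for y
          using that a(2) Ba[of a] by auto
      qed
      then have L_a: "L a = s a *\<^sub>R u"
        using lorentz_inner_nondegenerate[of "L a - s a *\<^sub>R u"] by simp
      then have "s a * (lorentz_inner u u + 1) = 0"
        using L_u[of a] by (simp add: linear_cmul[OF linear_lorentz_inner_left] algebra_simps)
      then have "L a = 0"
        using u(2) L_a by (auto simp: add_eq_0_iff2)
      with a(1) \<open>inj L\<close> show False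
        using linear_injective_0[OF linear_L] by blast
    qed
  qed
  then show ?thesis
    using inj_L hyperplane_through_iff_span[of v, OF assms(3)] by blast
qed

end
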